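(* Let $0<n<m$. The map $M_1:\mathcal P\to\mathcal D$, assigning to each doubly infinite path its sequence of domains and domain wall positions, is a bijection.
   Context: Paths. For $k\in\mathbb Z$, $0\le a\le m-n$, $0\le b\le n$ let $\bar p(k;a,b)=n-b$ if $k$ is odd, $a+b$ if $k\equiv0\pmod4$, $m-n-a+b$ if $k\equiv2\pmod4$. $P_{a,b;a',b'}$ is the set of sequences $(p(k))_{k\in\mathbb Z}$ with $p(k)\in\{0,\dots,n\}$ for $k$ odd, $p(k)\in\{0,\dots,m\}$ for $k$ even, $p(k)=\bar p(k;a,b)$ for $k\gg0$, $p(k)=\bar p(k;a',b')$ for $k\ll0$; $\mathcal P$ is the (disjoint) union of the $P_{a,b;a',b'}$ over all $0\le a,a'\le m-n$, $0\le b,b'\le n$. Domains. Given a path, a domain $(a(k),b(k))$ is assigned to every $k\in\mathbb Z$ by the following rule applied to every odd $k$: (i) if $n\le p(k+1)+p(k)\le m$: $b(k+1)=b(k)=n-p(k)$ and $a(k+1)=a(k)=m-p(k)-p(k+1)$ if $k\equiv1\pmod4$, $=p(k)+p(k+1)-n$ if $k\equiv3\pmod4$; (ii) if $p(k+1)+p(k)>m$: $b(k+1)=p(k+1)-m+n$, $b(k)=n-p(k)$, and $a(k+1)=a(k)=0$ if $k\equiv1\pmod4$, $=m-n$ if $k\equiv3\pmod4$; (iii) if $p(k+1)+p(k)<n$: $b(k+1)=p(k+1)$, $b(k)=n-p(k)$, and $a(k+1)=a(k)=m-n$ if $k\equiv1\pmod4$, $=0$ if $k\equiv3\pmod4$.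 The resulting $(a(k),b(k))_{k\in\mathbb Z}$ is written as a sequence of domains $(a_{N+1},b_{N+1})\cdots(a_1,b_1)$ (consecutive ones distinct) and integers $k_N>\cdots>k_1$ such that $(a(k),b(k))=(a_i,b_i)$ for $k_i\ge k>k_{i-1}$ (with $k_{N+1}=\infty$, $k_0=-\infty$). This defines $M_1$. The set $\mathcal D$ consists of all data: a domain sequence $(a_{N+1},b_{N+1})\cdots(a_1,b_1)$ and integers $k_N>k_{N-1}>\cdots>k_1$, where $N\in\mathbb Z_{\ge0}$, $0\le a_i\le m-n$, $0\le b_i\le n$, $(a_{i+1},b_{i+1})\ne(a_i,b_i)$, and $k_i\in2\mathbb Z\cup(1+4\mathbb Z)$ if $a_{i+1}=a_i=0$ and $b_{i+1}>b_i$, or if $a_{i+1}=a_i=m-n$ and $b_{i+1}<b_i$; $k_i\in2\mathbb Z\cup(3+4\mathbb Z)$ if $a_{i+1}=a_i=0$ and $b_{i+1}<b_i$, or if $a_{i+1}=a_i=m-n$ and $b_{i+1}>b_i$; $k_i\in2\mathbb Z$ otherwise. *)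

theory Defs imports Complex_Main
begin

text \<open>
  All quantities, including the parameters \<open>m\<close> and \<open>n\<close>, live in \<open>int\<close>, so that no subtraction
  is truncated; the ranges are imposed explicitly.
\<close>

definition pbar :: "int \<Rightarrow> int \<Rightarrow> int \<Rightarrow> int \<Rightarrow> int \<Rightarrow> int" where
  "pbar m n a b k =
     (if odd k then n - b
      else if k mod 4 = 0 then a + b
      else m - n - a + b)"

definition paths_between :: "int \<Rightarrow> int \<Rightarrow> int \<times> int \<Rightarrow> int \<times> int \<Rightarrow> (int \<Rightarrow> int) set" where
  "paths_between m n = (\<lambda>(a, b) (a', b').
     {p. (\<forall>k. odd k \<longrightarrow> p k \<in> {0..n}) \<and>
         (\<forall>k. even k \<longrightarrow> p k \<in> {0..m}) \<and>
         (\<forall>\<^sub>F k in at_top. p k = pbar m n a b k) \<and>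
         (\<forall>\<^sub>F k in at_bot. p k = pbar m n a' b' k)})"

definition domains :: "int \<Rightarrow> int \<Rightarrow> (int \<times> int) set" where
  "domains m n = {0..m - n} \<times> {0..n}"

definition paths :: "int \<Rightarrow> int \<Rightarrow> (int \<Rightarrow> int) set" where
  "paths m n = (\<Union>d\<in>domains m n. \<Union>d'\<in>domains m n. paths_between m n d d')"

text \<open>
  A path determines its boundary data, so the union defining \<^const>\<open>paths\<close> is disjoint
  and no tag has to be carried along.
\<close>

lemma paths_between_disjoint:
  assumes "p \<in> paths_between m n d d'" "p \<in> paths_between m n e e'"
  shows "d = e \<and> d' = e'"
proof -
  obtain a b a' b' c g c' g' where [simp]: "d = (a, b)" "d' = (a', b')" "e = (c, g)" "e' = (c', g')"
    by (metis surj_pair)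
  have "\<forall>\<^sub>F k in at_top. pbar m n a b k = pbar m n c g k"
    using assms unfolding paths_between_def by (auto elim: eventually_elim2)
  then obtain K where K: "\<And>k. k \<ge> K \<Longrightarrow> pbar m n a b k = pbar m n c g k"
    unfolding eventually_at_top_linorder by auto
  have "\<forall>\<^sub>F k in at_bot. pbar m n a' b' k = pbar m n c' g' k"
    using assms unfolding paths_between_def by (auto elim: eventually_elim2)
  then obtain L where L: "\<And>k. k \<le> L \<Longrightarrow> pbar m n a' b' k = pbar m n c' g' k"
    unfolding eventually_at_bot_linorder by auto
  have "pbar m n a b (4 * \<bar>K\<bar>) = pbar m n c g (4 * \<bar>K\<bar>)"
       "pbar m n a b (4 * \<bar>K\<bar> + 1) = pbar m n c g (4 * \<bar>K\<bar> + 1)"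
       "pbar m n a' b' (- 4 * \<bar>L\<bar>) = pbar m n c' g' (- 4 * \<bar>L\<bar>)"
       "pbar m n a' b' (- 4 * \<bar>L\<bar> - 1) = pbar m n c' g' (- 4 * \<bar>L\<bar> - 1)"
    by (rule K L; arith)+
  then show ?thesis by (simp add: pbar_def)
qed

text \<open>
  The domain at \<open>k\<close> comes from the rule applied to the odd number \<open>j\<close> with \<open>k \<in> {j, j + 1}\<close>.
\<close>

definition domain_at :: "int \<Rightarrow> int \<Rightarrow> (int \<Rightarrow> int) \<Rightarrow> int \<Rightarrow> int \<times> int" where
  "domain_at m n p k =
     (let j = (if odd k then k else k - 1) in
      if n \<le> p (j + 1) + p j \<and> p (j + 1) + p j \<le> m then
        (if j mod 4 = 1 then m - p j - p (j + 1) else p j + p (j + 1) - n,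
         n - p j)
      else if p (j + 1) + p j > m then
        (if j mod 4 = 1 then 0 else m - n,
         if k = j then n - p j else p (j + 1) - m + n)
      else
        (if j mod 4 = 1 then m - n else 0,
         if k = j then n - p j else p (j + 1)))"

text \<open>
  A domain sequence with its wall positions is a pair of lists \<open>(ds, ks)\<close> with increasing index:
  \<open>ds ! i\<close> is \<open>(a\<^bsub>i+1\<^esub>, b\<^bsub>i+1\<^esub>)\<close> for \<open>i \<le> N\<close>, and \<open>ks ! i\<close> is \<open>k\<^bsub>i+1\<^esub>\<close> for \<open>i < N\<close>, where
  \<open>N = length ks\<close>.  The conventions \<open>k\<^bsub>N+1\<^esub> = \<infinity>\<close> and \<open>k\<^bsub>0\<^esub> = -\<infinity>\<close> become the guards
  \<open>i < length ks\<close> and \<open>0 < i\<close>.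
\<close>

type_synonym wall_data = "(int \<times> int) list \<times> int list"

definition is_wall_data :: "(int \<Rightarrow> int \<times> int) \<Rightarrow> wall_data \<Rightarrow> bool" where
  "is_wall_data f = (\<lambda>(ds, ks).
     length ds = length ks + 1 \<and>
     sorted_wrt (<) ks \<and>
     (\<forall>i<length ks. ds ! (i + 1) \<noteq> ds ! i) \<and>
     (\<forall>i<length ds. \<forall>k.
        (i < length ks \<longrightarrow> k \<le> ks ! i) \<and> (0 < i \<longrightarrow> ks ! (i - 1) < k) \<longrightarrow> f k = ds ! i))"

definition M1 :: "int \<Rightarrow> int \<Rightarrow> (int \<Rightarrow> int) \<Rightarrow> wall_data" where
  "M1 m n p = (THE d. is_wall_data (domain_at m n p) d)"

lemma is_wall_dataD:
  assumes "is_wall_data f (ds, ks)" "i < length ds"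
    "i < length ks \<longrightarrow> k \<le> ks ! i" "0 < i \<longrightarrow> ks ! (i - 1) < k"
  shows "f k = ds ! i"
  using assms unfolding is_wall_data_def by blast

lemma is_wall_data_index:
  assumes "sorted_wrt (<) (ks :: int list)"
  obtains i where "i \<le> length ks" "i < length ks \<longrightarrow> k \<le> ks ! i" "0 < i \<longrightarrow> ks ! (i - 1) < k"
proof -
  define i where "i = (LEAST i. i = length ks \<or> (i < length ks \<and> k \<le> ks ! i))"
  have 1: "i = length ks \<or> (i < length ks \<and> k \<le> ks ! i)"
    unfolding i_def by (rule LeastI[where k = "length ks"]) simp
  have 2: "\<not> (j = length ks \<or> (j < length ks \<and> k \<le> ks ! j))" if "j < i" for j
    using not_less_Least that unfolding i_def by blast
  show ?thesis
    using 1 2[of "i - 1"] by (intro that[of i]) auto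
qed

lemma is_wall_data_walls:
  assumes "is_wall_data f (ds, ks)"
  shows "set ks = {k. f (k + 1) \<noteq> f k}"
proof (intro equalityI subsetI)
  have s: "sorted_wrt (<) ks" and l: "length ds = length ks + 1"
    and d: "\<And>i. i < length ks \<Longrightarrow> ds ! (i + 1) \<noteq> ds ! i"
    and f: "\<And>i k. i < length ds \<Longrightarrow> i < length ks \<longrightarrow> k \<le> ks ! i \<Longrightarrow>
              0 < i \<longrightarrow> ks ! (i - 1) < k \<Longrightarrow> f k = ds ! i"
    using assms unfolding is_wall_data_def by auto
  {
    fix k assume "k \<in> set ks"
    then obtain i where i: "i < length ks" "k = ks ! i" by (auto simp: in_set_conv_nth)
    have "f k = ds ! i"
      using i l s by (intro f) (auto simp: sorted_wrt_iff_nth_less)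
    moreover have "f (k + 1) = ds ! (i + 1)"
      using i l s by (intro f) (auto simp: sorted_wrt_iff_nth_less intro!: zless_imp_add1_zle)
    ultimately show "k \<in> {k. f (k + 1) \<noteq> f k}" using d[OF i(1)] by simp
  }
  fix k assume k: "k \<in> {k. f (k + 1) \<noteq> f k}"
  show "k \<in> set ks"
  proof (rule ccontr)
    assume n: "k \<notin> set ks"
    obtain i where i: "i \<le> length ks" "i < length ks \<longrightarrow> k \<le> ks ! i" "0 < i \<longrightarrow> ks ! (i - 1) < k"
      using is_wall_data_index[OF s] by metis
    have "i < length ks \<longrightarrow> k \<noteq> ks ! i" using n nth_mem by metis
    then have "f (k + 1) = ds ! i" using i l by (intro f) auto
    moreover have "f k = ds ! i" using i l by (intro f) auto
    ultimately show False using k by simp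
  qed
qed

text \<open>
  At most one datum describes \<open>f\<close>.  One exists exactly when \<open>f\<close> is eventually constant in both
  directions, as \<open>domain_at m n p\<close> is for a path \<open>p\<close>, so the definite description in
  \<^const>\<open>M1\<close> is proper on \<^const>\<open>paths\<close>.
\<close>

lemma is_wall_data_unique:
  assumes "is_wall_data f d" "is_wall_data f e"
  shows "d = e"
proof -
  obtain ds ks es ls where [simp]: "d = (ds, ks)" "e = (es, ls)" by (metis surj_pair)
  have "set ks = set ls" using assms is_wall_data_walls by simp
  moreover have "sorted_wrt (<) ks" "sorted_wrt (<) ls"
    using assms by (auto simp: is_wall_data_def)
  ultimately have [simp]: "ls = ks"
    by (simp add: strict_sorted_equal)
  have "ds = es"
  proof (rule nth_equalityI)
    show "length ds = length es" using assms by (simp add: is_wall_data_def)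
    fix i assume i: "i < length ds"
    define k where "k = (if i < length ks then ks ! i else if i = 0 then 0 else ks ! (i - 1) + 1)"
    have "(i < length ks \<longrightarrow> k \<le> ks ! i) \<and> (0 < i \<longrightarrow> ks ! (i - 1) < k)"
      using \<open>sorted_wrt (<) ks\<close> by (auto simp: k_def sorted_wrt_iff_nth_less)
    then have k: "i < length ks \<longrightarrow> k \<le> ks ! i" "0 < i \<longrightarrow> ks ! (i - 1) < k" by blast+
    have w: "is_wall_data f (ds, ks)" "is_wall_data f (es, ks)" using assms by simp_all
    have "f k = ds ! i" using is_wall_dataD[OF w(1) i k] .
    moreover have "f k = es ! i" using is_wall_dataD[OF w(2) _ k] i \<open>length ds = length es\<close> by simp
    ultimately show "ds ! i = es ! i" by simp
  qed
  then show ?thesis by simp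
qed

lemma M1_eqI: "is_wall_data (domain_at m n p) d \<Longrightarrow> M1 m n p = d"
  unfolding M1_def by (blast intro: is_wall_data_unique)

text \<open>
  Admissible positions of a wall with domain \<open>(a', b')\<close> above it (larger \<open>k\<close>) and \<open>(a, b)\<close> below it.
\<close>

definition wall_positions :: "int \<Rightarrow> int \<Rightarrow> int \<times> int \<Rightarrow> int \<times> int \<Rightarrow> int set" where
  "wall_positions m n = (\<lambda>(a', b') (a, b).
     if (a' = 0 \<and> a = 0 \<and> b' > b) \<or> (a' = m - n \<and> a = m - n \<and> b' < b)
       then {k. even k} \<union> {k. k mod 4 = 1}
     else if (a' = 0 \<and> a = 0 \<and> b' < b) \<or> (a' = m - n \<and> a = m - n \<and> b' > b)
       then {k. even k} \<union> {k. k mod 4 = 3}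
     else {k. even k})"

definition domain_data :: "int \<Rightarrow> int \<Rightarrow> wall_data set" where
  "domain_data m n =
     {(ds, ks). length ds = length ks + 1 \<and>
        sorted_wrt (<) ks \<and>
        set ds \<subseteq> domains m n \<and>
        (\<forall>i<length ks. ds ! (i + 1) \<noteq> ds ! i \<and>
           ks ! i \<in> wall_positions m n (ds ! (i + 1)) (ds ! i))}"

end

theory Submission imports Defs
begin

text \<open>
  The rule that produces the domains is inverted by a single formula: whichever of its three cases
  applies, the path is recovered pointwise as the ground state of the domain it currently sits in,
  \<open>p(k) = pbar(k; a(k), b(k))\<close> (lemma \<open>pbar_domain_at\<close>).  So the domain function \<open>domain_at m n p\<close>
  determines \<open>p\<close>, and what remains is to find out which functions \<open>f\<close> from \<open>\<int>\<close> to domains arise.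

  The rule is local to the pairs \<open>{j, j + 1}\<close> with \<open>j\<close> odd.  Since different pairs do not interact,
  an even position is never constrained, whereas at an odd \<open>j\<close> the pair of domains
  \<open>f(j), f(j + 1)\<close> comes from some \<open>p(j) \<in> {0..n}\<close>, \<open>p(j + 1) \<in> {0..m}\<close> exactly if the
  two domains coincide or \<open>j\<close> is an admissible wall position between them.  Case (i) of the rule
  yields the equal pairs; cases (ii) and (iii) yield the admissible jumps, up and down in \<open>b\<close>
  respectively (lemmas \<open>domain_at_wall_positions\<close> and \<open>domain_at_of_pbar\<close>).
  The boundary conditions on the path become the finiteness of the set of jumps of \<open>f\<close>.

  Such functions \<open>f\<close> and wall data determine each other: a function with finitely many
  jumps is a step function, described by its jumps and its successive values.
\<close>

section \<open>Step functions and their wall data\<close>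

lemma strict_sorted_nth_mono:
  fixes ks :: "int list"
  assumes "sorted_wrt (<) ks" "i \<le> j" "j < length ks"
  shows "ks ! i \<le> ks ! j"
  using assms by (cases "i = j") (auto simp: sorted_wrt_iff_nth_less le_less)

lemma int_fun_eq_of_no_jump:
  fixes f :: "int \<Rightarrow> 'a"
  assumes "x \<le> y" and "\<And>k. x \<le> k \<Longrightarrow> k < y \<Longrightarrow> f (k + 1) = f k"
  shows "f y = f x"
  using assms by (induction y rule: int_ge_induct) auto

lemma finite_jumps_imp_eventually_constant:
  fixes f :: "int \<Rightarrow> 'a"
  assumes "finite {k. f (k + 1) \<noteq> f k}"
  obtains K L where "\<And>k. K \<le> k \<Longrightarrow> f k = f K" and "\<And>k. k \<le> L \<Longrightarrow> f k = f L"
proof -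
  let ?W = "{k. f (k + 1) \<noteq> f k}"
  \<comment> \<open>The inserted \<open>0\<close> keeps the extrema meaningful when there are no jumps.\<close>
  define K where "K = Max (insert 0 ?W) + 1"
  define L where "L = Min (insert 0 ?W)"
  have bounds: "L \<le> k \<and> k < K" if "f (k + 1) \<noteq> f k" for k
  proof -
    have *: "finite (insert 0 ?W)" "k \<in> insert 0 ?W" using that assms by simp_all
    have "Min (insert 0 ?W) \<le> k" "k \<le> Max (insert 0 ?W)" by (rule Min_le[OF *], rule Max_ge[OF *])
    then show ?thesis unfolding K_def L_def by linarith
  qed
  show ?thesis
  proof
    fix k
    show "f k = f K" if "K \<le> k"
      using that
    proof (rule int_fun_eq_of_no_jump)
      show "f (x + 1) = f x" if "K \<le> x" for x using bounds[of x] that by linarith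
    qed
    show "f k = f L" if "k \<le> L"
    proof (rule int_fun_eq_of_no_jump[OF that, symmetric])
      show "f (x + 1) = f x" if "x < L" for x using bounds[of x] that by linarith
    qed
  qed
qed

lemma is_wall_data_exists:
  assumes "finite {k. f (k + 1) \<noteq> f k}"
  shows "\<exists>d. is_wall_data f d"
proof -
  define W where "W = {k. f (k + 1) \<noteq> f k}"
  define ks where "ks = sorted_list_of_set W"
  have W: "set ks = W" and s: "sorted_wrt (<) ks"
    using assms by (simp_all add: ks_def W_def)
  obtain K L where K: "\<And>k. K \<le> k \<Longrightarrow> f k = f K"
    using finite_jumps_imp_eventually_constant[OF assms] by metis
  define ds where "ds = map f ks @ [f K]"
  have ds: "f k = ds ! i"
    if i: "i < length ds" and up: "i < length ks \<longrightarrow> k \<le> ks ! i" and lo: "0 < i \<longrightarrow> ks ! (i - 1) < k"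
    for i k
  proof -
    \<comment> \<open>A point to the right of \<open>k\<close> in the same interval, at which \<open>f\<close> takes the value \<open>ds ! i\<close>
      by construction; an intermediate jump would be a wall strictly inside the interval.\<close>
    define y where "y = (if i < length ks then ks ! i else max k K)"
    have "f y = f k"
    proof (rule int_fun_eq_of_no_jump)
      show "k \<le> y" using up by (simp add: y_def)
      fix x assume x: "k \<le> x" "x < y"
      show "f (x + 1) = f x"
      proof (rule ccontr)
        assume "f (x + 1) \<noteq> f x"
        then obtain j where j: "j < length ks" "x = ks ! j"
          using W by (metis (mono_tags, lifting) W_def in_set_conv_nth mem_Collect_eq)
        have "j < i"
        proof (rule ccontr)
          assume "\<not> j < i"
          then have "i < length ks" "ks ! i \<le> ks ! j"
            using j strict_sorted_nth_mono[OF s, of i j] by auto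
          then show False using x j by (simp add: y_def)
        qed
        then have "ks ! j \<le> ks ! (i - 1)"
          using i by (intro strict_sorted_nth_mono[OF s]) (auto simp: ds_def)
        then show False using \<open>j < i\<close> lo x j by simp
      qed
    qed
    moreover have "f y = ds ! i"
      using i K[of "max k K"] by (auto simp: y_def ds_def nth_append)
    ultimately show ?thesis by simp
  qed
  have "ds ! (i + 1) \<noteq> ds ! i" if i: "i < length ks" for i
  proof -
    have "f (ks ! i + 1) = ds ! (i + 1)"
      using i s by (intro ds) (auto simp: ds_def sorted_wrt_iff_nth_less intro!: zless_imp_add1_zle)
    moreover have "ds ! i = f (ks ! i)" using i by (simp add: ds_def nth_append)
    moreover have "ks ! i \<in> W" using i W nth_mem by blast
    ultimately show ?thesis by (simp add: W_def)
  qed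
  then have "is_wall_data f (ds, ks)"
    using s ds by (auto simp: is_wall_data_def ds_def)
  then show ?thesis by blast
qed

lemma is_wall_data_function_unique:
  assumes "is_wall_data f d" and "is_wall_data g d"
  shows "f = g"
proof
  fix k
  obtain ds ks where d: "d = (ds, ks)" by (metis surj_pair)
  have s: "sorted_wrt (<) ks" "length ds = length ks + 1"
    using assms by (auto simp: is_wall_data_def d)
  obtain i where i: "i \<le> length ks" "i < length ks \<longrightarrow> k \<le> ks ! i" "0 < i \<longrightarrow> ks ! (i - 1) < k"
    using is_wall_data_index[OF s(1)] by metis
  then show "f k = g k"
    using is_wall_dataD[OF assms(1)[unfolded d] _ i(2,3)] is_wall_dataD[OF assms(2)[unfolded d] _ i(2,3)]
      i(1) s by simp
qed

text \<open>
  The least index \<open>i\<close> whose wall \<open>ks ! i\<close> is not below \<open>k\<close> (or \<open>length ks\<close>, past all walls) is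
  the index of the interval containing \<open>k\<close>, so it selects the value of the step function at \<open>k\<close>.
\<close>

lemma is_wall_data_realizable:
  assumes len: "length ds = length ks + 1" and s: "sorted_wrt (<) ks"
    and ne: "\<And>i. i < length ks \<Longrightarrow> ds ! (i + 1) \<noteq> ds ! i"
  shows "\<exists>f. is_wall_data f (ds, ks)"
proof -
  define f where "f k = ds ! (LEAST i. i < length ks \<longrightarrow> k \<le> ks ! i)" for k
  have "f k = ds ! i"
    if i: "i < length ds" and up: "i < length ks \<longrightarrow> k \<le> ks ! i" and lo: "0 < i \<longrightarrow> ks ! (i - 1) < k"
    for i k
  proof -
    have "(LEAST i. i < length ks \<longrightarrow> k \<le> ks ! i) = i"
    proof (rule Least_equality)
      fix j assume j: "j < length ks \<longrightarrow> k \<le> ks ! j"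
      show "i \<le> j"
      proof (rule ccontr)
        assume "\<not> i \<le> j"
        then have "ks ! j \<le> ks ! (i - 1)"
          using i len by (intro strict_sorted_nth_mono[OF s]) auto
        then show False using \<open>\<not> i \<le> j\<close> j lo i len by auto
      qed
    qed (rule up)
    then show ?thesis by (simp add: f_def)
  qed
  then have "is_wall_data f (ds, ks)"
    using assms by (auto simp: is_wall_data_def)
  then show ?thesis by blast
qed

lemma is_wall_data_at_wall:
  assumes "is_wall_data f (ds, ks)" and "i < length ks"
  shows "f (ks ! i) = ds ! i" and "f (ks ! i + 1) = ds ! (i + 1)"
  using assms
  by (auto intro!: is_wall_dataD[OF assms(1)] zless_imp_add1_zle
      simp: is_wall_data_def sorted_wrt_iff_nth_less)

lemma is_wall_data_range:
  assumes w: "is_wall_data f (ds, ks)"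
  shows "set ds = range f"
proof (intro equalityI subsetI)
  have s: "sorted_wrt (<) ks" and len: "length ds = length ks + 1"
    using w by (auto simp: is_wall_data_def)
  {
    fix d assume "d \<in> set ds"
    then obtain i where i: "i < length ds" "d = ds ! i" by (auto simp: in_set_conv_nth)
    show "d \<in> range f"
    proof (cases "i < length ks")
      case True
      then show ?thesis using is_wall_data_at_wall(1)[OF w True] i by (metis rangeI)
    next
      case False
      then have "f (if i = 0 then 0 else ks ! (i - 1) + 1) = ds ! i"
        using i by (intro is_wall_dataD[OF w]) auto
      then show ?thesis using i by (metis rangeI)
    qed
  }
  fix d assume "d \<in> range f"
  then obtain k where k: "d = f k" by blast
  obtain i where i: "i \<le> length ks" "i < length ks \<longrightarrow> k \<le> ks ! i" "0 < i \<longrightarrow> ks ! (i - 1) < k"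
    using is_wall_data_index[OF s] by metis
  then show "d \<in> set ds" using is_wall_dataD[OF w _ i(2,3)] i(1) k len by simp
qed

section \<open>Admissible domain functions\<close>

text \<open>
  These are the domain functions of paths.  The condition on walls has content at odd positions
  only, since all even positions are admissible.
\<close>

definition domain_functions :: "int \<Rightarrow> int \<Rightarrow> (int \<Rightarrow> int \<times> int) set" where
  "domain_functions m n =
     {f. range f \<subseteq> domains m n \<and> finite {k. f (k + 1) \<noteq> f k} \<and>
         (\<forall>k. f (k + 1) \<noteq> f k \<longrightarrow> k \<in> wall_positions m n (f (k + 1)) (f k))}"

lemma even_in_wall_positions: "even k \<Longrightarrow> k \<in> wall_positions m n d' d"
  by (auto simp: wall_positions_def split: prod.splits)

lemma is_wall_data_domain_data_iff:
  assumes "is_wall_data f d"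
  shows "d \<in> domain_data m n \<longleftrightarrow> f \<in> domain_functions m n"
proof -
  obtain ds ks where d: "d = (ds, ks)" by (metis surj_pair)
  then have w: "is_wall_data f (ds, ks)" using assms by simp
  have walls: "{k. f (k + 1) \<noteq> f k} = set ks" using is_wall_data_walls[OF w] by simp
  have "(\<forall>k. f (k + 1) \<noteq> f k \<longrightarrow> k \<in> wall_positions m n (f (k + 1)) (f k)) \<longleftrightarrow>
        (\<forall>k\<in>set ks. k \<in> wall_positions m n (f (k + 1)) (f k))"
    using walls by blast
  also have "\<dots> \<longleftrightarrow> (\<forall>i<length ks. ks ! i \<in> wall_positions m n (ds ! (i + 1)) (ds ! i))"
    by (simp add: all_set_conv_all_nth is_wall_data_at_wall[OF w])
  finally show ?thesis
    using w walls is_wall_data_range[OF w]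
    by (auto simp: d domain_functions_def domain_data_def is_wall_data_def)
qed

section \<open>Paths and their domain functions\<close>

text \<open>
  The inverse of the domain rule.  In case (i), \<open>a\<close> is chosen so that \<open>p(j)\<close> and \<open>p(j + 1)\<close> both
  agree with the ground state; in cases (ii) and (iii), \<open>a\<close> is extreme, and \<open>b(j + 1)\<close> is
  \<open>p(j + 1)\<close> shifted by the offset \<open>0\<close> or \<open>m - n\<close> of the ground state at \<open>j + 1\<close>.
\<close>

lemma pbar_domain_at:
  "pbar m n (fst (domain_at m n p k)) (snd (domain_at m n p k)) k = p k"
proof (cases "odd k")
  case True
  then show ?thesis by (simp add: pbar_def domain_at_def Let_def)
next
  case False
  then have "(k - 1) mod 4 = 1 \<longleftrightarrow> k mod 4 \<noteq> 0" by presburger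
  then show ?thesis using False by (auto simp: pbar_def domain_at_def Let_def)
qed

lemma domain_at_in_domains:
  assumes "n < m" and "\<And>k. odd k \<Longrightarrow> p k \<in> {0..n}" and "\<And>k. even k \<Longrightarrow> p k \<in> {0..m}"
  shows "domain_at m n p k \<in> domains m n"
proof -
  define j where "j = (if odd k then k else k - 1)"
  have "p j \<in> {0..n}" "p (j + 1) \<in> {0..m}" using assms(2,3) by (auto simp: j_def)
  then show ?thesis
    using assms(1) unfolding domain_at_def Let_def j_def[symmetric] domains_def by auto
qed

text \<open>
  A jump at an odd position means that the rule is in case (ii), where \<open>b(j + 1) > b(j)\<close>, or in
  case (iii), where \<open>b(j + 1) < b(j)\<close>.  In each case the residue of \<open>j\<close> modulo \<open>4\<close> decides
  whether the common value of \<open>a\<close> is \<open>0\<close> or \<open>m - n\<close>.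
\<close>

lemma domain_at_wall_positions:
  assumes "n < m" and jump: "domain_at m n p (k + 1) \<noteq> domain_at m n p k"
  shows "k \<in> wall_positions m n (domain_at m n p (k + 1)) (domain_at m n p k)"
proof (cases "even k")
  case True
  then show ?thesis by (rule even_in_wall_positions)
next
  case False
  then have "k mod 4 = 1 \<or> k mod 4 = 3" by presburger
  then show ?thesis
    using False assms by (auto simp: domain_at_def Let_def wall_positions_def split: if_splits)
qed

text \<open>
  The converse at the level of one pair.  If the two domains coincide, then \<open>p(j) + p(j + 1)\<close> lies
  between \<open>n\<close> and \<open>m\<close>, which is case (i).  Across an admissible odd wall from \<open>b\<close> to \<open>b'\<close> the sum is \<open>m + (b' - b)\<close> if
  \<open>b' > b\<close>, and \<open>n - (b - b')\<close> if \<open>b' < b\<close>, so that the rule selects case (ii) or (iii).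
\<close>

lemma domain_at_of_pbar:
  assumes "n < m" and "odd j"
    and "(a, b) \<in> domains m n"
    and wall: "(a', b') \<noteq> (a, b) \<Longrightarrow> j \<in> wall_positions m n (a', b') (a, b)"
    and p: "p j = pbar m n a b j" "p (j + 1) = pbar m n a' b' (j + 1)"
  shows "domain_at m n p j = (a, b)" and "domain_at m n p (j + 1) = (a', b')"
proof -
  have j: "j mod 4 = 1 \<and> (j + 1) mod 4 = 2 \<or> j mod 4 = 3 \<and> (j + 1) mod 4 = 0"
    using \<open>odd j\<close> by presburger
  have "domain_at m n p j = (a, b) \<and> domain_at m n p (j + 1) = (a', b')"
  proof (cases "(a', b') = (a, b)")
    case True
    then show ?thesis
      using assms(2,3) p j by (auto simp: domain_at_def Let_def pbar_def domains_def)
  next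
    case False
    from wall[OF this] show ?thesis
      using assms(1,2,3) p j False
      by (auto simp: domain_at_def Let_def pbar_def domains_def wall_positions_def split: if_splits)
  qed
  then show "domain_at m n p j = (a, b)" and "domain_at m n p (j + 1) = (a', b')" by auto
qed

text \<open>
  Where a path is in a ground state, its domain is the one labelling that state.  One neighbour
  on each side of \<open>k\<close> suffices, since the pair containing \<open>k\<close> is \<open>{k, k + 1}\<close> or \<open>{k - 1, k}\<close>.
\<close>

lemma domain_at_eq_of_local_pbar:
  assumes "n < m" and "(a, b) \<in> domains m n"
    and p: "\<And>i. \<bar>i - k\<bar> \<le> 1 \<Longrightarrow> p i = pbar m n a b i"
  shows "domain_at m n p k = (a, b)"
proof (cases "odd k")
  case True
  then show ?thesis using assms by (intro domain_at_of_pbar(1)[where a' = a and b' = b]) auto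
next
  case False
  then show ?thesis
    using domain_at_of_pbar(2)[where j = "k - 1" and a = a and b = b and a' = a and b' = b and p = p]
      assms by auto
qed

lemma domain_at_in_domain_functions:
  assumes "n < m" and "p \<in> paths m n"
  shows "domain_at m n p \<in> domain_functions m n"
proof -
  obtain a b a' b' where ab: "(a, b) \<in> domains m n" "(a', b') \<in> domains m n"
    and p: "p \<in> paths_between m n (a, b) (a', b')"
    using assms(2) by (auto simp: paths_def)
  obtain K where K: "\<And>k. K \<le> k \<Longrightarrow> p k = pbar m n a b k"
    using p by (auto simp: paths_between_def eventually_at_top_linorder)
  obtain L where L: "\<And>k. k \<le> L \<Longrightarrow> p k = pbar m n a' b' k"
    using p by (auto simp: paths_between_def eventually_at_bot_linorder)
  have hi: "domain_at m n p k = (a, b)" if "K < k" for k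
    using that by (intro domain_at_eq_of_local_pbar assms ab K) auto
  have lo: "domain_at m n p k = (a', b')" if "k < L" for k
    using that by (intro domain_at_eq_of_local_pbar assms ab L) auto
  have "{k. domain_at m n p (k + 1) \<noteq> domain_at m n p k} \<subseteq> {L - 1..K}"
  proof (clarsimp, rule conjI)
    fix k assume ne: "domain_at m n p (k + 1) \<noteq> domain_at m n p k"
    show "L - 1 \<le> k" using lo[of k] lo[of "k + 1"] ne by (cases "k + 1 < L") auto
    show "k \<le> K" using hi[of k] hi[of "k + 1"] ne by (cases "K < k") auto
  qed
  then have "finite {k. domain_at m n p (k + 1) \<noteq> domain_at m n p k}"
    using finite_subset by blast
  moreover have "domain_at m n p k \<in> domains m n" for k
    using p assms(1) by (intro domain_at_in_domains) (auto simp: paths_between_def)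
  ultimately show ?thesis
    using domain_at_wall_positions[OF assms(1)] by (auto simp: domain_functions_def)
qed

lemma pbar_range:
  assumes "n < m" and "d \<in> domains m n"
  shows "odd k \<Longrightarrow> pbar m n (fst d) (snd d) k \<in> {0..n}"
    and "even k \<Longrightarrow> pbar m n (fst d) (snd d) k \<in> {0..m}"
  using assms by (auto simp: pbar_def domains_def)

text \<open>
  The only candidate for the path is dictated by \<open>pbar_domain_at\<close>.  Its boundary data are the
  constant values of \<open>f\<close> beyond the outermost jumps.
\<close>

lemma ex_path_of_domain_function:
  assumes "n < m" and f: "f \<in> domain_functions m n"
  obtains p where "p \<in> paths m n" and "domain_at m n p = f"
proof -
  define p where "p k = pbar m n (fst (f k)) (snd (f k)) k" for k
  have f_dom: "f k \<in> domains m n" for k using f by (auto simp: domain_functions_def)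
  have f_wall: "f (k + 1) \<noteq> f k \<Longrightarrow> k \<in> wall_positions m n (f (k + 1)) (f k)" for k
    using f by (auto simp: domain_functions_def)
  have pair: "domain_at m n p j = f j \<and> domain_at m n p (j + 1) = f (j + 1)" if "odd j" for j
  proof -
    obtain a b a' b' where ab: "f j = (a, b)" "f (j + 1) = (a', b')" by (metis surj_pair)
    show ?thesis
      using domain_at_of_pbar[OF assms(1) that, of a b a' b' p] f_dom[of j] f_wall[of j] ab
      by (simp add: p_def)
  qed
  have "domain_at m n p k = f k" for k
    using pair[of k] pair[of "k - 1"] by (cases "odd k") auto
  then have "domain_at m n p = f" by (rule ext)
  obtain K L where K: "\<And>k. K \<le> k \<Longrightarrow> f k = f K" and L: "\<And>k. k \<le> L \<Longrightarrow> f k = f L"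
    using f finite_jumps_imp_eventually_constant[of f] unfolding domain_functions_def by blast
  have "\<forall>\<^sub>F k in at_top. p k = pbar m n (fst (f K)) (snd (f K)) k"
    unfolding eventually_at_top_linorder p_def using K by metis
  moreover have "\<forall>\<^sub>F k in at_bot. p k = pbar m n (fst (f L)) (snd (f L)) k"
    unfolding eventually_at_bot_linorder p_def using L by metis
  moreover have "odd k \<Longrightarrow> p k \<in> {0..n}" "even k \<Longrightarrow> p k \<in> {0..m}" for k
    using pbar_range[OF assms(1) f_dom] by (auto simp: p_def)
  ultimately have "p \<in> paths_between m n (f K) (f L)"
    by (simp add: paths_between_def case_prod_beta)
  then have "p \<in> paths m n" using f_dom by (auto simp: paths_def)
  then show ?thesis using \<open>domain_at m n p = f\<close> that by blast
qed

lemma is_wall_data_M1: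
  assumes "n < m" and "p \<in> paths m n"
  shows "is_wall_data (domain_at m n p) (M1 m n p)"
  using is_wall_data_exists[of "domain_at m n p"] domain_at_in_domain_functions[OF assms] M1_eqI
  by (auto simp: domain_functions_def)

theorem proposition7p2:
  fixes m n :: int
  assumes "0 < n" and "n < m"
  shows "bij_betw (M1 m n) (paths m n) (domain_data m n)"
proof (rule bij_betw_imageI)
  show "inj_on (M1 m n) (paths m n)"
  proof (rule inj_onI)
    fix p q assume pq: "p \<in> paths m n" "q \<in> paths m n" "M1 m n p = M1 m n q"
    have "is_wall_data (domain_at m n q) (M1 m n p)"
      using is_wall_data_M1[OF assms(2) pq(2)] pq(3) by simp
    then have eq: "domain_at m n p = domain_at m n q"
      using is_wall_data_M1[OF assms(2) pq(1)] is_wall_data_function_unique by blast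
    show "p = q"
    proof
      fix k show "p k = q k"
        using pbar_domain_at[of m n p k] pbar_domain_at[of m n q k] eq by simp
    qed
  qed
  show "M1 m n ` paths m n = domain_data m n"
  proof (intro equalityI image_subsetI subsetI)
    fix p assume p: "p \<in> paths m n"
    show "M1 m n p \<in> domain_data m n"
      using is_wall_data_domain_data_iff[OF is_wall_data_M1[OF assms(2) p]]
        domain_at_in_domain_functions[OF assms(2) p] by blast
  next
    fix d assume d: "d \<in> domain_data m n"
    obtain ds ks where ds: "d = (ds, ks)" by (metis surj_pair)
    obtain f where w: "is_wall_data f d"
      using d is_wall_data_realizable[of ds ks] by (auto simp: domain_data_def ds)
    then have "f \<in> domain_functions m n"
      using d is_wall_data_domain_data_iff by blast
    then obtain p where "p \<in> paths m n" "domain_at m n p = f"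
      using ex_path_of_domain_function[OF assms(2)] by blast
    moreover from this w have "M1 m n p = d" by (intro M1_eqI) simp
    ultimately show "d \<in> M1 m n ` paths m n" by blast
  qed
qed

end
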